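(* Let $(\mathcal{A},\mu,\alpha)$ be a multiplicative Hom-associative algebra over a field $k$ such that $\alpha$ is an element of the centroid, i.e. $\alpha(x)y=x\alpha(y)=\alpha(xy)$ for all $x,y\in\mathcal{A}$. Then $(\mathcal{A}^\ast,\alpha^\ast)$, where $\mathcal{A}^\ast$ is the algebraic dual and $\alpha^\ast(f)=f\circ\alpha$, is an $\mathcal{A}$-bimodule via the coregular actions $(a\cdot f)(b)=f(ba)$ and $(f\cdot a)(b)=f(ab)$.
   Context: A Hom-associative algebra $(\mathcal{A},\mu,\alpha)$ over a field $k$ is a $k$-vector space $\mathcal{A}$ with linear maps $\mu:\mathcal{A}\otimes\mathcal{A}\to\mathcal{A}$, written $ab$, and $\alpha:\mathcal{A}\to\mathcal{A}$ such that $\alpha(a)(bc)=(ab)\alpha(c)$. It is multiplicative if $\alpha(ab)=\alpha(a)\alpha(b)$. No unit is assumed. An $\mathcal{A}$-bimodule $(V,\beta)$ is a vector space $V$ with bilinear actions $a\cdot v\in V$, $v\cdot a\in V$ and a linear map $\beta:V\to V$ such that for all $a,b\in\mathcal{A}$, $v\in V$: $(ab)\cdot\beta(v)=\alpha(a)\cdot(b\cdot v)$ (left module), $\beta(v)\cdot(ab)=(v\cdot a)\cdot\alpha(b)$ (right module), and $\alpha(a)\cdot(v\cdot b)=(a\cdot v)\cdot\alpha(b)$. *)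

theory Defs
  imports "HOL-Algebra.Module"
begin

section \<open>Vector spaces and (bi)linear maps on carriers\<close>

locale vector_space = field K + module K V for K (structure) and V (structure)

definition linear_map ::
  "('k, 'p) ring_scheme \<Rightarrow> ('k, 'v, 'q) module_scheme \<Rightarrow> ('k, 'w, 'r) module_scheme
    \<Rightarrow> ('v \<Rightarrow> 'w) \<Rightarrow> bool"
  where "linear_map K V W f \<longleftrightarrow>
    f \<in> carrier V \<rightarrow> carrier W \<and>
    (\<forall>x\<in>carrier V. \<forall>y\<in>carrier V. f (x \<oplus>\<^bsub>V\<^esub> y) = f x \<oplus>\<^bsub>W\<^esub> f y) \<and>
    (\<forall>c\<in>carrier K. \<forall>x\<in>carrier V. f (c \<odot>\<^bsub>V\<^esub> x) = c \<odot>\<^bsub>W\<^esub> f x)"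

definition bilinear_map ::
  "('k, 'p) ring_scheme \<Rightarrow> ('k, 'u, 'q) module_scheme \<Rightarrow> ('k, 'v, 'r) module_scheme
    \<Rightarrow> ('k, 'w, 's) module_scheme \<Rightarrow> ('u \<Rightarrow> 'v \<Rightarrow> 'w) \<Rightarrow> bool"
  where "bilinear_map K U V W g \<longleftrightarrow>
    (\<forall>u\<in>carrier U. linear_map K V W (\<lambda>v. g u v)) \<and>
    (\<forall>v\<in>carrier V. linear_map K U W (\<lambda>u. g u v))"


section \<open>Hom-associative algebras and their bimodules\<close>

text \<open>
  The product of the algebra is the field \<open>mult\<close> of the record \<open>A\<close>. The field \<open>one\<close> of \<open>A\<close>
  is never used: neither associativity nor a unit is assumed.
\<close>

locale hom_assoc_algebra = vector_space K A for K (structure) and A (structure) +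
  fixes \<alpha> :: "'c \<Rightarrow> 'c"
  assumes mult_bilinear: "bilinear_map K A A A (\<lambda>a b. a \<otimes>\<^bsub>A\<^esub> b)"
    and alpha_linear: "linear_map K A A \<alpha>"
    and hom_assoc: "\<lbrakk>a \<in> carrier A; b \<in> carrier A; c \<in> carrier A\<rbrakk>
      \<Longrightarrow> \<alpha> a \<otimes>\<^bsub>A\<^esub> (b \<otimes>\<^bsub>A\<^esub> c) = (a \<otimes>\<^bsub>A\<^esub> b) \<otimes>\<^bsub>A\<^esub> \<alpha> c"

locale multiplicative_hom_assoc_algebra = hom_assoc_algebra +
  assumes alpha_mult: "\<lbrakk>a \<in> carrier A; b \<in> carrier A\<rbrakk> \<Longrightarrow> \<alpha> (a \<otimes>\<^bsub>A\<^esub> b) = \<alpha> a \<otimes>\<^bsub>A\<^esub> \<alpha> b"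

definition centroid ::
  "('k, 'p) ring_scheme \<Rightarrow> ('k, 'a, 'q) module_scheme \<Rightarrow> ('a \<Rightarrow> 'a) set"
  where "centroid K A = {\<phi>. linear_map K A A \<phi> \<and>
    (\<forall>x\<in>carrier A. \<forall>y\<in>carrier A.
      \<phi> x \<otimes>\<^bsub>A\<^esub> y = x \<otimes>\<^bsub>A\<^esub> \<phi> y \<and> x \<otimes>\<^bsub>A\<^esub> \<phi> y = \<phi> (x \<otimes>\<^bsub>A\<^esub> y))}"

text \<open>\<open>lact a v\<close> is the left action \<open>a \<cdot> v\<close>, and \<open>ract v a\<close> is the right action \<open>v \<cdot> a\<close>.\<close>

locale hom_bimodule =
  hom_assoc_algebra K A \<alpha> + V: vector_space K V
  for K (structure) and A (structure) and \<alpha> and V (structure) +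
  fixes \<beta> :: "'e \<Rightarrow> 'e"
    and lact :: "'c \<Rightarrow> 'e \<Rightarrow> 'e"
    and ract :: "'e \<Rightarrow> 'c \<Rightarrow> 'e"
  assumes beta_linear: "linear_map K V V \<beta>"
    and lact_bilinear: "bilinear_map K A V V lact"
    and ract_bilinear: "bilinear_map K V A V ract"
    and left_module: "\<lbrakk>a \<in> carrier A; b \<in> carrier A; v \<in> carrier V\<rbrakk>
      \<Longrightarrow> lact (a \<otimes>\<^bsub>A\<^esub> b) (\<beta> v) = lact (\<alpha> a) (lact b v)"
    and right_module: "\<lbrakk>a \<in> carrier A; b \<in> carrier A; v \<in> carrier V\<rbrakk>
      \<Longrightarrow> ract (\<beta> v) (a \<otimes>\<^bsub>A\<^esub> b) = ract (ract v a) (\<alpha> b)"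
    and bimodule_compat: "\<lbrakk>a \<in> carrier A; b \<in> carrier A; v \<in> carrier V\<rbrakk>
      \<Longrightarrow> lact (\<alpha> a) (ract v b) = ract (lact a v) (\<alpha> b)"


section \<open>The algebraic dual and the coregular actions\<close>

text \<open>
  Functionals are functions on \<open>carrier V\<close>, made \<open>undefined\<close> outside it so that equality of
  functionals is equality of functions. The fields \<open>mult\<close> and \<open>one\<close> of the record play no role
  in a vector space.
\<close>

definition dual ::
  "('k, 'p) ring_scheme \<Rightarrow> ('k, 'v, 'q) module_scheme \<Rightarrow> ('k, 'v \<Rightarrow> 'k) module"
  where "dual K V =
    \<lparr> carrier = {f \<in> carrier V \<rightarrow>\<^sub>E carrier K.
        (\<forall>x\<in>carrier V. \<forall>y\<in>carrier V. f (x \<oplus>\<^bsub>V\<^esub> y) = f x \<oplus>\<^bsub>K\<^esub> f y) \<and>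
        (\<forall>c\<in>carrier K. \<forall>x\<in>carrier V. f (c \<odot>\<^bsub>V\<^esub> x) = c \<otimes>\<^bsub>K\<^esub> f x)},
      monoid.mult = undefined,
      one = undefined,
      zero = (\<lambda>x\<in>carrier V. \<zero>\<^bsub>K\<^esub>),
      add = (\<lambda>f g. \<lambda>x\<in>carrier V. f x \<oplus>\<^bsub>K\<^esub> g x),
      smult = (\<lambda>c f. \<lambda>x\<in>carrier V. c \<otimes>\<^bsub>K\<^esub> f x) \<rparr>"

definition dual_map :: "('k, 'v, 'q) module_scheme \<Rightarrow> ('v \<Rightarrow> 'v) \<Rightarrow> ('v \<Rightarrow> 'k) \<Rightarrow> 'v \<Rightarrow> 'k"
  where "dual_map V \<phi> f = (\<lambda>x\<in>carrier V. f (\<phi> x))"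

definition coregular_left :: "('k, 'a, 'q) module_scheme \<Rightarrow> 'a \<Rightarrow> ('a \<Rightarrow> 'k) \<Rightarrow> 'a \<Rightarrow> 'k"
  where "coregular_left A a f = (\<lambda>b\<in>carrier A. f (b \<otimes>\<^bsub>A\<^esub> a))"

definition coregular_right :: "('k, 'a, 'q) module_scheme \<Rightarrow> ('a \<Rightarrow> 'k) \<Rightarrow> 'a \<Rightarrow> 'a \<Rightarrow> 'k"
  where "coregular_right A f a = (\<lambda>b\<in>carrier A. f (a \<otimes>\<^bsub>A\<^esub> b))"

end

theory Submission
  imports Defs
begin

text \<open>
  Both coregular actions and \<open>\<alpha>\<^sup>*\<close> are transposes of linear maps, so linearity is formal. Each
  bimodule axiom, evaluated at \<open>f\<close> and \<open>c\<close>, asks that \<open>f\<close> agree on two triple products with one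
  twist \<open>\<alpha>\<close>. Centroidality moves \<open>\<alpha>\<close> onto any factor of such a product, and
  Hom-associativity changes the bracketing: for the left module axiom,
  \<open>\<alpha>(c(ab)) = \<alpha>(c)(ab) = (ca)\<alpha>(b) = \<alpha>(ca)b = (c\<alpha>(a))b\<close>.
\<close>

lemma linear_mapD:
  assumes "linear_map K V W f"
  shows "x \<in> carrier V \<Longrightarrow> f x \<in> carrier W"
    and "x \<in> carrier V \<Longrightarrow> y \<in> carrier V \<Longrightarrow> f (x \<oplus>\<^bsub>V\<^esub> y) = f x \<oplus>\<^bsub>W\<^esub> f y"
    and "c \<in> carrier K \<Longrightarrow> x \<in> carrier V \<Longrightarrow> f (c \<odot>\<^bsub>V\<^esub> x) = c \<odot>\<^bsub>W\<^esub> f x"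
  using assms by (auto simp: linear_map_def)

lemma bilinear_mapD:
  assumes "bilinear_map K U V W g"
  shows "u \<in> carrier U \<Longrightarrow> linear_map K V W (\<lambda>v. g u v)"
    and "v \<in> carrier V \<Longrightarrow> linear_map K U W (\<lambda>u. g u v)"
  using assms by (auto simp: bilinear_map_def)

lemma dual_carrierD:
  assumes "f \<in> carrier (dual K V)"
  shows "f \<in> extensional (carrier V)"
    and "x \<in> carrier V \<Longrightarrow> f x \<in> carrier K"
    and "x \<in> carrier V \<Longrightarrow> y \<in> carrier V \<Longrightarrow> f (x \<oplus>\<^bsub>V\<^esub> y) = f x \<oplus>\<^bsub>K\<^esub> f y"
    and "c \<in> carrier K \<Longrightarrow> x \<in> carrier V \<Longrightarrow> f (c \<odot>\<^bsub>V\<^esub> x) = c \<otimes>\<^bsub>K\<^esub> f x"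
  using assms by (auto simp: dual_def PiE_iff)

text \<open>Functionals are \<open>undefined\<close> off the carrier, so their values on it
  determine them. This reduces each vector space axiom for the dual to a pointwise identity in the
  field.\<close>

lemma dual_eqI:
  assumes "f \<in> carrier (dual K V)" "g \<in> carrier (dual K V)"
    and "\<And>x. x \<in> carrier V \<Longrightarrow> f x = g x"
  shows "f = g"
  using assms by (metis dual_carrierD(1) extensionalityI)

lemma dual_apply:
  assumes "x \<in> carrier V"
  shows "(f \<oplus>\<^bsub>dual K V\<^esub> g) x = f x \<oplus>\<^bsub>K\<^esub> g x"
    and "\<zero>\<^bsub>dual K V\<^esub> x = \<zero>\<^bsub>K\<^esub>"
    and "(c \<odot>\<^bsub>dual K V\<^esub> f) x = c \<otimes>\<^bsub>K\<^esub> f x"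
  using assms by (simp_all add: dual_def)

context vector_space
begin

text \<open>A common membership test: sums, scalar multiples and transposes of functionals all arise
  by restricting a pointwise formula to the carrier.\<close>

lemma restrict_in_dual:
  assumes "\<And>x. x \<in> carrier V \<Longrightarrow> g x \<in> carrier K"
    and "\<And>x y. x \<in> carrier V \<Longrightarrow> y \<in> carrier V \<Longrightarrow> g (x \<oplus>\<^bsub>V\<^esub> y) = g x \<oplus> g y"
    and "\<And>c x. c \<in> carrier K \<Longrightarrow> x \<in> carrier V \<Longrightarrow> g (c \<odot>\<^bsub>V\<^esub> x) = c \<otimes> g x"
  shows "(\<lambda>x\<in>carrier V. g x) \<in> carrier (dual K V)"
  using assms by (simp add: dual_def)

lemma dual_add_closed:
  assumes "f \<in> carrier (dual K V)" "g \<in> carrier (dual K V)"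
  shows "f \<oplus>\<^bsub>dual K V\<^esub> g \<in> carrier (dual K V)"
proof -
  note fg = assms[THEN dual_carrierD(2)] assms[THEN dual_carrierD(3)] assms[THEN dual_carrierD(4)]
  have "(\<lambda>x\<in>carrier V. f x \<oplus> g x) \<in> carrier (dual K V)"
    by (rule restrict_in_dual) (simp_all add: fg cring.cring_simprules[OF is_cring])
  then show ?thesis by (simp add: dual_def)
qed

lemma dual_zero_closed: "\<zero>\<^bsub>dual K V\<^esub> \<in> carrier (dual K V)"
proof -
  have "(\<lambda>x\<in>carrier V. \<zero>) \<in> carrier (dual K V)"
    by (rule restrict_in_dual) simp_all
  then show ?thesis by (simp add: dual_def)
qed

lemma dual_smult_closed:
  assumes "c \<in> carrier K" "f \<in> carrier (dual K V)"
  shows "c \<odot>\<^bsub>dual K V\<^esub> f \<in> carrier (dual K V)"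
proof -
  note f = dual_carrierD(2-4)[OF assms(2)]
  have "(\<lambda>x\<in>carrier V. c \<otimes> f x) \<in> carrier (dual K V)"
    by (rule restrict_in_dual) (simp_all add: f assms(1) m_ac r_distr)
  then show ?thesis by (simp add: dual_def)
qed

lemmas dual_closed = dual_add_closed dual_zero_closed dual_smult_closed

lemma vector_space_dual: "Defs.vector_space K (dual K V)"
proof -
  have "abelian_group (dual K V)"
  proof (rule abelian_groupI)
    fix f assume f: "f \<in> carrier (dual K V)"
    \<comment> \<open>The additive inverse of \<open>f\<close> is taken to be its multiple by -1,
      which lies in the dual by closure under scalar multiplication.\<close>
    have minus_one: "\<ominus> \<one> \<in> carrier K" by simp
    have "(\<ominus> \<one> \<odot>\<^bsub>dual K V\<^esub> f) \<oplus>\<^bsub>dual K V\<^esub> f = \<zero>\<^bsub>dual K V\<^esub>"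
      using f by (intro dual_eqI[of _ K V])
        (simp_all add: dual_closed dual_apply dual_carrierD(2) cring.cring_simprules[OF is_cring])
    then show "\<exists>g\<in>carrier (dual K V). g \<oplus>\<^bsub>dual K V\<^esub> f = \<zero>\<^bsub>dual K V\<^esub>"
      using dual_smult_closed[OF minus_one f] by blast
  qed (auto intro!: dual_eqI[of _ K V]
      simp: dual_closed dual_apply dual_carrierD(2) cring.cring_simprules[OF is_cring])
  moreover have "module_axioms K (dual K V)"
    by unfold_locales (auto intro!: dual_eqI[of _ K V]
        simp: dual_closed dual_apply dual_carrierD(2) l_distr r_distr m_ac)
  ultimately show ?thesis
    by (intro Defs.vector_space.intro module.intro field_axioms is_cring)
qed

lemma dual_map_closed:
  assumes "linear_map K V W \<phi>" "f \<in> carrier (dual K W)"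
  shows "dual_map V \<phi> f \<in> carrier (dual K V)"
  unfolding dual_map_def
  by (rule restrict_in_dual) (simp_all add: linear_mapD[OF assms(1)] dual_carrierD[OF assms(2)])

text \<open>Operations on functionals are pointwise, so precomposition with \<open>\<phi>\<close>
  respects them. This serves both for \<open>\<alpha>\<close> and for multiplication by a fixed
  element, where it yields linearity of the actions in the functional.\<close>

lemma linear_map_dual_map:
  assumes W: "Defs.vector_space K W" and \<phi>: "linear_map K V W \<phi>"
  shows "linear_map K (dual K W) (dual K V) (dual_map V \<phi>)"
proof -
  interpret W: Defs.vector_space K W by (rule W)
  have apply_map: "dual_map V \<phi> f x = f (\<phi> x)" if "x \<in> carrier V" for f x
    using that by (simp add: dual_map_def)
  show ?thesis
    unfolding linear_map_def
    by (auto intro!: dual_eqI[of _ K V] simp: dual_map_closed[OF \<phi>] W.dual_closed dual_closed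
        apply_map dual_apply linear_mapD(1)[OF \<phi>])
qed

text \<open>
  The hypothesis on \<open>U\<close> is needed because \<open>linear_map\<close> alone does not say that \<open>carrier U\<close> is
  closed under the operations.
\<close>

lemma linear_map_dual_map_param:
  assumes U: "Defs.vector_space K U" and g: "bilinear_map K U V W g"
    and f: "f \<in> carrier (dual K W)"
  shows "linear_map K U (dual K V) (\<lambda>u. dual_map V (g u) f)"
proof -
  interpret U: Defs.vector_space K U by (rule U)
  have closed: "dual_map V (g u) f \<in> carrier (dual K V)" if "u \<in> carrier U" for u
    using bilinear_mapD(1)[OF g that] f by (rule dual_map_closed)
  have apply_map: "dual_map V (g u) f x = f (g u x)" if "x \<in> carrier V" for u x
    using that by (simp add: dual_map_def)
  note g' = bilinear_mapD(2)[OF g, THEN linear_mapD(1)]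
    bilinear_mapD(2)[OF g, THEN linear_mapD(2)] bilinear_mapD(2)[OF g, THEN linear_mapD(3)]
  show ?thesis
    unfolding linear_map_def
    by (auto intro!: dual_eqI[of _ K V] simp: closed dual_closed apply_map dual_apply g'
        dual_carrierD[OF f])
qed

end

theorem proposition2p11:
  fixes K :: "('k, 'p) ring_scheme"
    and A :: "('k, 'a, 'q) module_scheme"
    and \<alpha> :: "'a \<Rightarrow> 'a"
  assumes "multiplicative_hom_assoc_algebra K A \<alpha>"
    and "\<alpha> \<in> centroid K A"
  shows "hom_bimodule K A \<alpha> (dual K A) (dual_map A \<alpha>) (coregular_left A) (coregular_right A)"
proof -
  interpret multiplicative_hom_assoc_algebra K A \<alpha> by (rule assms(1))
  have A: "Defs.vector_space K A" by unfold_locales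
  \<comment> \<open>The left action of \<open>a\<close> is the transpose of right multiplication by
    \<open>a\<close>, and the right action that of left multiplication.\<close>
  have left: "coregular_left A a = dual_map A (\<lambda>b. b \<otimes>\<^bsub>A\<^esub> a)" for a
    by (simp add: fun_eq_iff coregular_left_def dual_map_def)
  have right: "coregular_right A f a = dual_map A (\<lambda>b. a \<otimes>\<^bsub>A\<^esub> b) f" for f a
    by (simp add: fun_eq_iff coregular_right_def dual_map_def)
  \<comment> \<open>The factors are swapped because the left action multiplies by its parameter on
    the right, while \<open>linear_map_dual_map_param\<close> expects the parameter as first
    argument.\<close>
  have mult_bilinear': "bilinear_map K A A A (\<lambda>a b. b \<otimes>\<^bsub>A\<^esub> a)"
    using mult_bilinear by (auto simp: bilinear_map_def)
  have left_bilinear: "bilinear_map K A (dual K A) (dual K A) (coregular_left A)"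
    unfolding bilinear_map_def left
    using linear_map_dual_map[OF A bilinear_mapD(2)[OF mult_bilinear]]
      linear_map_dual_map_param[OF A mult_bilinear'] by blast
  have right_bilinear: "bilinear_map K (dual K A) A (dual K A) (coregular_right A)"
    unfolding bilinear_map_def right
    using linear_map_dual_map[OF A bilinear_mapD(1)[OF mult_bilinear]]
      linear_map_dual_map_param[OF A mult_bilinear] by blast
  have mult_closed [simp]: "x \<otimes>\<^bsub>A\<^esub> y \<in> carrier A" if "x \<in> carrier A" "y \<in> carrier A" for x y
    using linear_mapD(1)[OF bilinear_mapD(1)[OF mult_bilinear]] that by simp
  note [simp] = linear_mapD(1)[OF alpha_linear]
  have alpha_left: "\<alpha> (x \<otimes>\<^bsub>A\<^esub> y) = \<alpha> x \<otimes>\<^bsub>A\<^esub> y"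
    and alpha_right: "\<alpha> (x \<otimes>\<^bsub>A\<^esub> y) = x \<otimes>\<^bsub>A\<^esub> \<alpha> y"
    if "x \<in> carrier A" "y \<in> carrier A" for x y
    using assms(2) that by (auto simp: centroid_def)
  \<comment> \<open>These are the arguments of \<open>f\<close> on the two sides of the left, right
    and compatibility axioms, evaluated at \<open>c\<close>.\<close>
  have twist_left: "\<alpha> (c \<otimes>\<^bsub>A\<^esub> (a \<otimes>\<^bsub>A\<^esub> b)) = (c \<otimes>\<^bsub>A\<^esub> \<alpha> a) \<otimes>\<^bsub>A\<^esub> b"
    and twist_right: "\<alpha> ((a \<otimes>\<^bsub>A\<^esub> b) \<otimes>\<^bsub>A\<^esub> c) = a \<otimes>\<^bsub>A\<^esub> (\<alpha> b \<otimes>\<^bsub>A\<^esub> c)"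
    and twist_middle: "b \<otimes>\<^bsub>A\<^esub> (c \<otimes>\<^bsub>A\<^esub> \<alpha> a) = (\<alpha> b \<otimes>\<^bsub>A\<^esub> c) \<otimes>\<^bsub>A\<^esub> a"
    if abc: "a \<in> carrier A" "b \<in> carrier A" "c \<in> carrier A" for a b c
  proof -
    \<comment> \<open>Both bracketings agree after applying \<alpha>: \<alpha>(x(yz)) =
      \<alpha>(x)(yz) = (xy)\<alpha>(z) = \<alpha>((xy)z).\<close>
    have assoc: "\<alpha> (x \<otimes>\<^bsub>A\<^esub> (y \<otimes>\<^bsub>A\<^esub> z)) = \<alpha> ((x \<otimes>\<^bsub>A\<^esub> y) \<otimes>\<^bsub>A\<^esub> z)"
      if "x \<in> carrier A" "y \<in> carrier A" "z \<in> carrier A" for x y z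
      using that hom_assoc[of x y z] alpha_left[of x "y \<otimes>\<^bsub>A\<^esub> z"] alpha_right[of "x \<otimes>\<^bsub>A\<^esub> y" z]
      by simp
    show "\<alpha> (c \<otimes>\<^bsub>A\<^esub> (a \<otimes>\<^bsub>A\<^esub> b)) = (c \<otimes>\<^bsub>A\<^esub> \<alpha> a) \<otimes>\<^bsub>A\<^esub> b"
      \<comment> \<open>Here c\<alpha>(a) = \<alpha>(ca) = \<alpha>(c)a, so with \<alpha> moved to
        the leftmost factor both sides become (\<alpha>(c)a)b. The next identity is the mirror
        image, with \<alpha> on the rightmost factor.\<close>
      using abc assoc[of c a b] by (simp add: alpha_left flip: alpha_right[of c a])
    show "\<alpha> ((a \<otimes>\<^bsub>A\<^esub> b) \<otimes>\<^bsub>A\<^esub> c) = a \<otimes>\<^bsub>A\<^esub> (\<alpha> b \<otimes>\<^bsub>A\<^esub> c)"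
      using abc assoc[of a b c] by (simp add: alpha_right flip: alpha_left[of b c])
    \<comment> \<open>The twist is pulled out of the whole product, the brackets are changed under
      it, and it is then pushed onto \<open>b\<close>.\<close>
    have "b \<otimes>\<^bsub>A\<^esub> (c \<otimes>\<^bsub>A\<^esub> \<alpha> a) = \<alpha> (b \<otimes>\<^bsub>A\<^esub> (c \<otimes>\<^bsub>A\<^esub> a))"
      using abc by (simp add: alpha_right)
    also have "\<dots> = (\<alpha> b \<otimes>\<^bsub>A\<^esub> c) \<otimes>\<^bsub>A\<^esub> a"
      using abc assoc[of b c a] by (simp add: alpha_left)
    finally show "b \<otimes>\<^bsub>A\<^esub> (c \<otimes>\<^bsub>A\<^esub> \<alpha> a) = (\<alpha> b \<otimes>\<^bsub>A\<^esub> c) \<otimes>\<^bsub>A\<^esub> a" .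
  qed
  show ?thesis
  proof (intro hom_bimodule.intro hom_bimodule_axioms.intro vector_space_dual
      hom_assoc_algebra_axioms left_bilinear right_bilinear)
    show "linear_map K (dual K A) (dual K A) (dual_map A \<alpha>)"
      by (rule linear_map_dual_map[OF A alpha_linear])
  next
    fix a b f assume ab: "a \<in> carrier A" "b \<in> carrier A"
    \<comment> \<open>Both sides are restrictions to the carrier, so comparing values at its points
      suffices. Closure under products removes the inner restrictions.\<close>
    show "coregular_left A (a \<otimes>\<^bsub>A\<^esub> b) (dual_map A \<alpha> f)
        = coregular_left A (\<alpha> a) (coregular_left A b f)"
      using ab by (auto simp: coregular_left_def dual_map_def twist_left intro!: restrict_ext)
    show "coregular_right A (dual_map A \<alpha> f) (a \<otimes>\<^bsub>A\<^esub> b)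
        = coregular_right A (coregular_right A f a) (\<alpha> b)"
      using ab by (auto simp: coregular_right_def dual_map_def twist_right intro!: restrict_ext)
    show "coregular_left A (\<alpha> a) (coregular_right A f b)
        = coregular_right A (coregular_left A a f) (\<alpha> b)"
      using ab by (auto simp: coregular_left_def coregular_right_def twist_middle
          intro!: restrict_ext)
  qed
qed

end
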